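(* Let $Q$ be an even positive-definite quadratic form of level two in $v$ variables. If $8 \mid v$, then there exist a positive integer $n$ with $2n \le 2 + \frac v4$ and $\mathbf{x} \in \mathbb{Z}^v$ with $Q(\mathbf{x}) = 2n$. If $v \equiv 4 \pmod 8$, then there exist a positive integer $n$ with $2n \le 1 + \frac v4$ and $\mathbf{x} \in \mathbb{Z}^v$ with $Q(\mathbf{x}) = 2n$.
   Context: For even $v$, let $A$ be a $v\times v$ symmetric matrix with integer entries, even diagonal entries, and positive eigenvalues; the associated even positive-definite quadratic form is $Q_A(\mathbf{x}) = {}^t\mathbf{x} A \mathbf{x}$ for column vectors $\mathbf{x} \in \mathbb{Z}^v$. The level of $Q_A$ is the smallest positive integer $N$ such that $N A^{-1}$ has integer entries and even diagonal entries. (For a level two form, $v$ is necessarily divisible by 4.) *)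

theory Defs
  imports "Jordan_Normal_Form.Matrix" "Jordan_Normal_Form.Char_Poly"
begin

definition even_pd_form :: "nat \<Rightarrow> int mat \<Rightarrow> bool" where
  "even_pd_form v A \<longleftrightarrow>
     A \<in> carrier_mat v v \<and> transpose_mat A = A \<and>
     (\<forall>i<v. even (A $$ (i, i))) \<and>
     (\<forall>k::real. eigenvalue (map_mat real_of_int A) k \<longrightarrow> k > 0)"

definition level_ok :: "nat \<Rightarrow> int mat \<Rightarrow> nat \<Rightarrow> bool" where
  "level_ok v A N \<longleftrightarrow>
     (\<exists>B \<in> carrier_mat v v.
        map_mat rat_of_int A * B = 1\<^sub>m v \<and> B * map_mat rat_of_int A = 1\<^sub>m v \<and>
        (\<forall>i<v. \<forall>j<v. of_nat N * B $$ (i, j) \<in> \<int>) \<and>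
        (\<forall>i<v. \<exists>k::int. of_nat N * B $$ (i, i) = of_int (2 * k)))"

definition form_level :: "nat \<Rightarrow> int mat \<Rightarrow> nat" where
  "form_level v A = (LEAST N. N > 0 \<and> level_ok v A N)"

definition qf :: "int mat \<Rightarrow> int vec \<Rightarrow> int" where
  "qf A x = x \<bullet> (A *\<^sub>v x)"

end

theory Submission
  imports Defs "HOL-Analysis.Ball_Volume"
begin

text \<open>
  The bound follows from Blichfeldt's argument in the geometry of numbers, without modular forms.
  Suppose that \<open>Q\<close> takes values \<open>\<ge> d\<close> at all nonzero integer vectors. If points \<open>y\<^sub>1, \<dots>, y\<^sub>k\<close> differ by
  such vectors, then \<open>k \<Sum> Q(y\<^sub>i) \<ge> \<Sum>\<^bsub>i<j\<^esub> Q(y\<^sub>i - y\<^sub>j) \<ge> d k (k - 1) / 2\<close>, so the translates by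
  integer vectors of \<open>max 0 (1 - 2 Q / d)\<close> add up to at most 1. Integrating over a unit cube gives, for
  \<open>v = 2m\<close>, that \<open>(\<pi> d / 2)\<^sup>m / (m + 1)! \<le> sqrt (det A)\<close>. At level two, \<open>2 A\<^sup>-\<^sup>1\<close> is integral, so
  \<open>det A \<le> 4\<^sup>m\<close>. If one of the claims failed, \<open>d = (m + 6) / 2\<close> would be admissible, which contradicts
  \<open>(m + 1)! < (\<pi> (m + 6) / 8)\<^sup>m\<close>.
\<close>

hide_const (open) Finite_Cartesian_Product.mat Finite_Cartesian_Product.vec

section \<open>Periodization over the integer lattice\<close>

text \<open>The half-open unit intervals that start at the integers partition the line, and
  translation carries each of them onto [0, 1). Enumerating the integers by
  \<open>int_decode\<close> turns the sum into a series over the naturals, which commutes with the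
  integral.\<close>

lemma nn_integral_lborel_periodization:
  fixes g :: "real \<Rightarrow> ennreal"
  assumes [measurable]: "g \<in> borel_measurable borel"
  shows "(\<integral>\<^sup>+y. g y \<partial>lborel) =
    (\<integral>\<^sup>+y. indicator {0..<1} y * (\<Sum>k. g (y + of_int (int_decode k))) \<partial>lborel)"
proof -
  define I :: "nat \<Rightarrow> real set" where "I k = {of_int (int_decode k)..<of_int (int_decode k) + 1}" for k
  have I_iff: "y \<in> I k \<longleftrightarrow> \<lfloor>y\<rfloor> = int_decode k" for y k
    unfolding I_def by (auto simp: floor_eq_iff)
  have disj: "disjoint_family I"
    unfolding disjoint_family_on_def using I_iff injD[OF inj_int_decode] by auto
  have [measurable]: "I k \<in> sets borel" for k
    unfolding I_def by simp
  have "(\<integral>\<^sup>+y. g y \<partial>lborel) = (\<integral>\<^sup>+y. (\<Sum>k. g y * indicator (I k) y) \<partial>lborel)"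
  proof (rule nn_integral_cong)
    fix y :: real
    have "y \<in> I (int_encode \<lfloor>y\<rfloor>)"
      by (simp add: I_iff)
    from suminf_cmult_indicator[OF disj this, of "\<lambda>_. g y"]
    show "g y = (\<Sum>k. g y * indicator (I k) y)" by simp
  qed
  also have "\<dots> = (\<Sum>k. \<integral>\<^sup>+y. g y * indicator (I k) y \<partial>lborel)"
    by (rule nn_integral_suminf) measurable
  also have "\<dots> = (\<Sum>k. \<integral>\<^sup>+y. indicator {0..<1} y * g (y + of_int (int_decode k)) \<partial>lborel)"
  proof (rule suminf_cong)
    fix k
    have "(\<integral>\<^sup>+y. g y * indicator (I k) y \<partial>lborel) =
      (\<integral>\<^sup>+y. g (of_int (int_decode k) + 1 * y) * indicator (I k) (of_int (int_decode k) + 1 * y) \<partial>lborel)"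
      by (subst nn_integral_real_affine[where c = 1 and t = "of_int (int_decode k)"]) auto
    also have "\<dots> = (\<integral>\<^sup>+y. indicator {0..<1} y * g (y + of_int (int_decode k)) \<partial>lborel)"
      by (rule nn_integral_cong) (auto simp: I_def indicator_def add.commute)
    finally show "(\<integral>\<^sup>+y. g y * indicator (I k) y \<partial>lborel) = \<dots>" .
  qed
  also have "\<dots> = (\<integral>\<^sup>+y. (\<Sum>k. indicator {0..<1} y * g (y + of_int (int_decode k))) \<partial>lborel)"
    by (rule nn_integral_suminf[symmetric]) measurable
  finally show ?thesis by simp
qed

text \<open>Induction on the number of coordinates, folding the last one onto [0, 1). The condition
  \<open>l i = 0\<close> for \<open>n \<le> i\<close> makes each vector of \<open>n\<close> integers
  correspond to exactly one function, so that finite sets \<open>S\<close> count no translate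
  twice.\<close>

lemma nn_integral_PiM_le_one:
  fixes F :: "(nat \<Rightarrow> real) \<Rightarrow> ennreal"
  assumes "F \<in> borel_measurable (PiM {..<n} (\<lambda>_. lborel))"
    and "\<And>x S. finite S \<Longrightarrow> (\<And>l i. l \<in> S \<Longrightarrow> n \<le> i \<Longrightarrow> l i = 0) \<Longrightarrow>
      (\<Sum>l\<in>S. F (\<lambda>i. x i + of_int (l i))) \<le> 1"
  shows "(\<integral>\<^sup>+x. F x \<partial>PiM {..<n} (\<lambda>_. lborel)) \<le> 1"
  using assms
proof (induction n arbitrary: F)
  case 0
  interpret product_sigma_finite "\<lambda>_::nat. lborel :: real measure"
    by standard
  show ?case
    \<comment> \<open>In dimension 0 the measure is the unit mass at
      \<open>\<lambda>_. undefined\<close>, and the zero vector is the only translation.\<close>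
    using "0.prems"(2)[of "{\<lambda>_. 0}" "\<lambda>_. undefined"] by (simp add: nn_integral_empty)
next
  case (Suc n)
  interpret product_sigma_finite "\<lambda>_::nat. lborel :: real measure"
    by standard
  let ?M = "\<lambda>n. PiM {..<n} (\<lambda>_. lborel :: real measure)"
  have ins: "{..<Suc n} = insert n {..<n}" by auto
  have Fm[measurable]: "F \<in> borel_measurable (PiM (insert n {..<n}) (\<lambda>_. lborel))"
    using Suc.prems(1) by (simp add: ins)
  have upd[measurable]: "(\<lambda>p. F ((fst p)(n := snd p))) \<in> borel_measurable (?M n \<Otimes>\<^sub>M lborel)"
    by measurable
  \<comment> \<open>\<open>G y\<close> is \<open>F\<close> summed over all integer translates of
    coordinate \<open>n\<close>. For each fixed \<open>y\<close> it satisfies the hypothesis in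
    dimension \<open>n\<close>.\<close>
  define G where "G y x = (\<Sum>k. F (x(n := y + of_int (int_decode k))))" for y x
  have G: "(\<integral>\<^sup>+x. G y x \<partial>?M n) \<le> 1" for y
  proof (rule Suc.IH)
    show "G y \<in> borel_measurable (?M n)"
      unfolding G_def by measurable
  next
    fix x :: "nat \<Rightarrow> real" and S :: "(nat \<Rightarrow> int) set"
    assume S: "finite S" and l0: "\<And>l i. l \<in> S \<Longrightarrow> n \<le> i \<Longrightarrow> l i = 0"
    have *: "(\<Sum>l\<in>S. \<Sum>k<K. F ((\<lambda>i. x i + of_int (l i))(n := y + of_int (int_decode k)))) \<le> 1" for K
    proof -
      \<comment> \<open>Appending an integer in coordinate \<open>n\<close> to the vectors of
        \<open>S\<close> yields distinct vectors admissible in dimension \<open>Suc n\<close>. The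
        cut at \<open>K\<close> keeps the set finite; the supremum over \<open>K\<close> is taken
        afterwards.\<close>
      let ?c = "\<lambda>(l, k). l(n := int_decode k)"
      have inj: "inj_on ?c (S \<times> {..<K})"
      proof (rule inj_onI, clarify)
        fix l k l' k' assume A: "l \<in> S" "l' \<in> S" "l(n := int_decode k) = l'(n := int_decode k')"
        \<comment> \<open>The update hides coordinate \<open>n\<close>, but \<open>l\<close> and
          \<open>l'\<close> both vanish there.\<close>
        have "l i = l' i" for i
          using fun_cong[OF A(3), of i] l0[OF A(1), of n] l0[OF A(2), of n] by (cases "i = n") auto
        moreover have "k = k'"
          using fun_cong[OF A(3), of n] injD[OF inj_int_decode] by simp
        ultimately show "l = l' \<and> k = k'" by auto
      qed
      have "(\<Sum>l\<in>S. \<Sum>k<K. F ((\<lambda>i. x i + of_int (l i))(n := y + of_int (int_decode k)))) =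
        (\<Sum>p\<in>S \<times> {..<K}. F (\<lambda>i. (x(n := y)) i + of_int (?c p i)))"
        unfolding sum.cartesian_product
        by (intro sum.cong refl, clarify, rule arg_cong[where f = F]) (simp add: fun_eq_iff)
      also have "\<dots> = (\<Sum>l\<in>?c ` (S \<times> {..<K}). F (\<lambda>i. (x(n := y)) i + of_int (l i)))"
        by (subst sum.reindex[OF inj]) simp
      also have "\<dots> \<le> 1"
        using S l0 by (intro Suc.prems(2)) auto
      finally show ?thesis .
    qed
    have "(\<Sum>l\<in>S. G y (\<lambda>i. x i + of_int (l i))) =
      (\<Sum>k. \<Sum>l\<in>S. F ((\<lambda>i. x i + of_int (l i))(n := y + of_int (int_decode k))))"
      unfolding G_def by (rule suminf_sum[symmetric]) simp
    also have "\<dots> \<le> 1"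
      using * by (subst suminf_eq_SUP, subst sum.swap) (auto intro: SUP_least)
    finally show "(\<Sum>l\<in>S. G y (\<lambda>i. x i + of_int (l i))) \<le> 1" .
  qed
  have pf: "pair_sigma_finite (?M n) (lborel :: real measure)"
    by (simp add: sigma_finite pair_sigma_finite.intro sigma_finite_measures)
  have "(\<integral>\<^sup>+x. F x \<partial>?M (Suc n)) = (\<integral>\<^sup>+x. \<integral>\<^sup>+y. F (x(n := y)) \<partial>lborel \<partial>?M n)"
    unfolding ins by (rule product_nn_integral_insert) auto
  also have "\<dots> = (\<integral>\<^sup>+x. \<integral>\<^sup>+y. indicator {0..<1} y * G y x \<partial>lborel \<partial>?M n)"
  proof (rule nn_integral_cong)
    fix x assume "x \<in> space (?M n)"
    then have "(\<lambda>y. F (x(n := y))) \<in> borel_measurable borel"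
      using measurable_compose[OF measurable_Pair1' upd, of x] by simp
    from nn_integral_lborel_periodization[OF this]
    show "(\<integral>\<^sup>+y. F (x(n := y)) \<partial>lborel) = (\<integral>\<^sup>+y. indicator {0..<1} y * G y x \<partial>lborel)"
      by (simp add: G_def)
  qed
  \<comment> \<open>After the exchange the inner integral runs over \<open>x\<close> with
    \<open>y\<close> fixed, where the bound on \<open>G y\<close> applies.\<close>
  also have "\<dots> = (\<integral>\<^sup>+y. \<integral>\<^sup>+x. indicator {0..<1} y * G y x \<partial>?M n \<partial>lborel)"
    by (rule pair_sigma_finite.Fubini'[OF pf, symmetric]) (unfold G_def, measurable)
  also have "\<dots> = (\<integral>\<^sup>+y. indicator {0..<1} y * (\<integral>\<^sup>+x. G y x \<partial>?M n) \<partial>lborel)"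
    by (intro nn_integral_cong nn_integral_cmult) (unfold G_def, measurable)
  also have "\<dots> \<le> (\<integral>\<^sup>+y. indicator {0..<1} (y::real) \<partial>lborel)"
    using G by (intro nn_integral_mono) (auto simp: indicator_def)
  also have "\<dots> = 1" by simp
  finally show ?case .
qed

section \<open>Quadratic forms and ellipsoids\<close>


text \<open>Coefficients and vectors are functions on the naturals with a separate dimension, so
  that induction can drop the last variable and the points of \<open>PiM\<close> can be inserted
  directly.\<close>

definition quad_form :: "nat \<Rightarrow> (nat \<Rightarrow> nat \<Rightarrow> 'a::comm_ring_1) \<Rightarrow> (nat \<Rightarrow> 'a) \<Rightarrow> 'a" where
  "quad_form n a x = (\<Sum>i<n. \<Sum>j<n. a i j * x i * x j)"

definition bilin :: "nat \<Rightarrow> (nat \<Rightarrow> nat \<Rightarrow> 'a::comm_ring_1) \<Rightarrow> (nat \<Rightarrow> 'a) \<Rightarrow> (nat \<Rightarrow> 'a) \<Rightarrow> 'a" where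
  "bilin n a x y = (\<Sum>i<n. \<Sum>j<n. a i j * x i * y j)"

lemma quad_form_Suc:
  assumes "\<And>i j. a i j = a j i"
  shows "quad_form (Suc n) a x =
    quad_form n a x + 2 * x n * (\<Sum>i<n. a i n * x i) + a n n * (x n)\<^sup>2"
proof -
  have "(\<Sum>j<n. a n j * x n * x j) = x n * (\<Sum>i<n. a i n * x i)"
    unfolding sum_distrib_left
    by (intro sum.cong refl) (subst assms, simp)
  moreover have "(\<Sum>i<n. a i n * x i * x n) = x n * (\<Sum>i<n. a i n * x i)"
    unfolding sum_distrib_left by (intro sum.cong) (simp_all add: algebra_simps)
  ultimately show ?thesis
    by (simp add: quad_form_def sum.distrib algebra_simps power2_eq_square)
qed

lemma quad_form_cong:
  "(\<And>i. i < n \<Longrightarrow> x i = y i) \<Longrightarrow> quad_form n a x = quad_form n a y"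
  unfolding quad_form_def by (intro sum.cong) auto

lemma quad_form_scale: "quad_form n a (\<lambda>i. c * x i) = c\<^sup>2 * quad_form n a x"
  unfolding quad_form_def by (simp add: sum_distrib_left power2_eq_square algebra_simps)

lemma quad_form_diff:
  assumes sym: "\<And>i j. a i j = a j i"
  shows "quad_form n a (\<lambda>i. x i - y i) =
    quad_form n a x + quad_form n a y - 2 * bilin n a x y"
proof -
  have "(\<Sum>i<n. \<Sum>j<n. a i j * y i * x j) = (\<Sum>i<n. \<Sum>j<n. a i j * x i * y j)"
    by (subst sum.swap) (intro sum.cong refl, subst sym, simp)
  then show ?thesis
    by (simp add: quad_form_def bilin_def algebra_simps sum.distrib sum_subtractf)
qed

text \<open>Symmetry is asked at all indices, also from \<open>n\<close> on, so that it serves as an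
  unconditional equation.\<close>

definition pos_def :: "nat \<Rightarrow> (nat \<Rightarrow> nat \<Rightarrow> real) \<Rightarrow> bool" where
  "pos_def n a \<longleftrightarrow> (\<forall>i j. a i j = a j i) \<and> (\<forall>x. (\<exists>i<n. x i \<noteq> 0) \<longrightarrow> quad_form n a x > 0)"

definition schur_compl :: "nat \<Rightarrow> (nat \<Rightarrow> nat \<Rightarrow> real) \<Rightarrow> nat \<Rightarrow> nat \<Rightarrow> real" where
  "schur_compl n a i j = a i j - a i n * a n j / a n n"

text \<open>Completing the square in the last variable. This reduces a linear change of variables to
  a one-dimensional affine substitution per coordinate.\<close>

lemma quad_form_schur_compl:
  assumes sym: "\<And>i j. a i j = a j i" and "a n n > 0"
  shows "quad_form (Suc n) a x =
    quad_form n (schur_compl n a) x + (sqrt (a n n) * x n + (\<Sum>i<n. a i n * x i) / sqrt (a n n))\<^sup>2"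
proof -
  let ?b = "\<Sum>i<n. a i n * x i"
  have "quad_form n (schur_compl n a) x = quad_form n a x - (\<Sum>i<n. \<Sum>j<n. (a i n * x i) * (a j n * x j)) / a n n"
  proof -
    have "schur_compl n a i j * x i * x j = a i j * x i * x j - (a i n * x i) * (a j n * x j) / a n n" for i j
      unfolding schur_compl_def sym[of n j] by (simp add: algebra_simps)
    then show ?thesis
      by (simp add: quad_form_def sum_subtractf sum_divide_distrib)
  qed
  also have "(\<Sum>i<n. \<Sum>j<n. (a i n * x i) * (a j n * x j)) = ?b\<^sup>2"
    by (simp add: power2_eq_square sum_product)
  finally have "quad_form n (schur_compl n a) x = quad_form n a x - ?b\<^sup>2 / a n n" .
  moreover have "(sqrt (a n n) * x n + ?b / sqrt (a n n))\<^sup>2 = a n n * (x n)\<^sup>2 + 2 * x n * ?b + ?b\<^sup>2 / a n n"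
    using assms(2) by (simp add: power2_sum power_mult_distrib power_divide)
  ultimately show ?thesis
    using quad_form_Suc[of a, OF sym] by simp
qed

lemma pos_def_nonneg:
  assumes "pos_def n a"
  shows "quad_form n a x \<ge> 0"
proof (cases "\<exists>i<n. x i \<noteq> 0")
  case False
  then show ?thesis by (simp add: quad_form_def)
qed (use assms in \<open>auto simp: pos_def_def intro: less_imp_le\<close>)

lemma pos_def_diag:
  assumes "pos_def (Suc n) a"
  shows "a n n > 0"
proof -
  let ?e = "\<lambda>i. of_bool (i = n) :: real"
  have "quad_form (Suc n) a ?e > 0"
  proof -
    have "\<exists>i<Suc n. ?e i \<noteq> 0"
      by (intro exI[of _ n]) simp
    then show ?thesis
      using assms[unfolded pos_def_def, THEN conjunct2, THEN spec[of _ ?e]] by simp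
  qed
  moreover have "quad_form (Suc n) a ?e = quad_form n a ?e + 2 * ?e n * (\<Sum>i<n. a i n * ?e i) + a n n * (?e n)\<^sup>2"
    using assms by (intro quad_form_Suc) (simp add: pos_def_def)
  moreover have "quad_form n a ?e = 0" "(\<Sum>i<n. a i n * ?e i) = 0"
    by (simp_all add: quad_form_def)
  ultimately show ?thesis by simp
qed

lemma pos_def_schur_compl:
  assumes "pos_def (Suc n) a"
  shows "pos_def n (schur_compl n a)"
  unfolding pos_def_def
proof (intro conjI allI impI)
  have sym: "a i j = a j i" for i j
    using assms by (simp add: pos_def_def)
  have pos: "a n n > 0"
    using assms by (rule pos_def_diag)
  show "schur_compl n a i j = schur_compl n a j i" for i j
    unfolding schur_compl_def sym[of i j] sym[of n j] sym[of i n] by simp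
  fix x :: "nat \<Rightarrow> real" assume x: "\<exists>i<n. x i \<noteq> 0"
  \<comment> \<open>This last coordinate annihilates the completed square, so the form at
    \<open>y\<close> equals the Schur complement at \<open>x\<close>.\<close>
  define y where "y = x(n := - (\<Sum>i<n. a i n * x i) / a n n)"
  have "(\<Sum>i<n. a i n * y i) = (\<Sum>i<n. a i n * x i)"
    unfolding y_def by (intro sum.cong) auto
  then have "sqrt (a n n) * y n + (\<Sum>i<n. a i n * y i) / sqrt (a n n) = 0"
    using pos by (simp add: y_def field_simps)
  then have "quad_form (Suc n) a y = quad_form n (schur_compl n a) y"
    using quad_form_schur_compl[of a n y, OF sym pos] by simp
  also have "\<dots> = quad_form n (schur_compl n a) x"
    by (rule quad_form_cong) (simp add: y_def)
  finally have eq: "quad_form (Suc n) a y = quad_form n (schur_compl n a) x" .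
  show "0 < quad_form n (schur_compl n a) x"
  proof -
    from x obtain i where "i < n" "x i \<noteq> 0" by blast
    then have "\<exists>i<Suc n. y i \<noteq> 0"
      by (intro exI[of _ i]) (simp add: y_def)
    then show ?thesis
      using assms by (simp add: pos_def_def flip: eq)
  qed
qed

text \<open>Multiplying by the unit lower triangular \<open>?U\<close> subtracts multiples of the
  last column from the others and clears the last row up to its corner entry. What remains is block
  upper triangular.\<close>

lemma det_schur_compl:
  assumes "a n n \<noteq> 0"
  shows "det (mat (Suc n) (Suc n) (\<lambda>(i, j). a i j)) =
    a n n * det (mat n n (\<lambda>(i, j). schur_compl n a i j))"
proof -
  let ?A = "mat (Suc n) (Suc n) (\<lambda>(i, j). a i j)"
  let ?S = "mat n n (\<lambda>(i, j). schur_compl n a i j)"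
  define u where "u i j = (if i = j then 1 else if i = n then - a n j / a n n else 0)" for i j
  let ?U = "mat (Suc n) (Suc n) (\<lambda>(i, j). u i j)"
  let ?B = "four_block_mat ?S (mat n 1 (\<lambda>(i, j). a i n)) (0\<^sub>m 1 n) (mat 1 1 (\<lambda>_. a n n))"
  have "?A * ?U = ?B"
  proof (rule eq_matI)
    fix i j assume "i < dim_row ?B" "j < dim_col ?B"
    then have ij: "i < Suc n" "j < Suc n" by simp_all
    have "(?A * ?U) $$ (i, j) = (\<Sum>k = 0..<Suc n. a i k * u k j)"
      using ij by (simp add: scalar_prod_def)
    also have "\<dots> = (\<Sum>k = 0..<n. a i k * u k j) + a i n * u n j"
      by simp
    also have "(\<Sum>k = 0..<n. a i k * u k j) = (\<Sum>k = 0..<n. if k = j then a i k else 0)"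
      by (rule sum.cong) (auto simp: u_def)
    also have "\<dots> = (if j < n then a i j else 0)"
      by (simp add: sum.delta)
    finally have eq: "(?A * ?U) $$ (i, j) = (if j < n then a i j else 0) + a i n * u n j" .
    show "(?A * ?U) $$ (i, j) = ?B $$ (i, j)"
    proof (cases "j < n")
      case True
      then show ?thesis
        unfolding eq using ij assms by (cases "i = n") (auto simp: u_def schur_compl_def)
    next
      case False
      then have "j = n" using ij by simp
      then show ?thesis
        unfolding eq using ij by (cases "i = n") (auto simp: u_def)
    qed
  qed simp_all
  then have "det ?A * det ?U = det ?B"
    using det_mult[of ?A "Suc n" ?U] by simp
  moreover have "det ?U = prod_list (diag_mat ?U)"
    by (rule det_lower_triangular[of "Suc n"]) (auto simp: u_def)
  moreover have "prod_list (diag_mat ?U) = 1"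
    by (simp add: prod_list_diag_prod u_def)
  moreover have "det ?B = det ?S * det (mat 1 1 (\<lambda>_. a n n))"
    by (rule det_four_block_mat_lower_left_zero[of _ n _ 1]) auto
  moreover have "det (mat 1 1 (\<lambda>_. a n n)) = a n n"
    by (subst det_single) auto
  ultimately show ?thesis by simp
qed

section \<open>Integrals of functions of a quadratic form\<close>

text \<open>Each completed square costs a factor \<open>1 / sqrt (a n n)\<close>, and by
  \<open>det_schur_compl\<close> these factors multiply up to the determinant. Its positivity comes
  out of the same induction.\<close>

lemma nn_integral_quad_form:
  assumes "pos_def n a" and "G \<in> borel_measurable borel"
  shows "det (mat n n (\<lambda>(i, j). a i j)) > 0 \<and>
    (\<integral>\<^sup>+x. G (quad_form n a x) \<partial>PiM {..<n} (\<lambda>_. lborel)) =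
    ennreal (1 / sqrt (det (mat n n (\<lambda>(i, j). a i j)))) *
      (\<integral>\<^sup>+x. G (\<Sum>i<n. (x i)\<^sup>2) \<partial>PiM {..<n} (\<lambda>_. lborel))"
  using assms
proof (induction n arbitrary: a G)
  case 0
  show ?case by (simp add: quad_form_def)
next
  case (Suc n)
  interpret product_sigma_finite "\<lambda>_::nat. lborel :: real measure"
    by standard
  let ?M = "\<lambda>n. PiM {..<n} (\<lambda>_. lborel :: real measure)"
  note [measurable] = Suc.prems(2)
  have ins: "{..<Suc n} = insert n {..<n}" by auto
  define s where "s = sqrt (a n n)"
  have pos: "a n n > 0"
    using Suc.prems(1) by (rule pos_def_diag)
  then have s: "s > 0" by (simp add: s_def)
  have sym: "a i j = a j i" for i j
    using Suc.prems(1) by (simp add: pos_def_def)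
  \<comment> \<open>\<open>H\<close> absorbs the integral over the last variable; this is why the
    induction runs over arbitrary \<open>G\<close>.\<close>
  define H where "H t = (\<integral>\<^sup>+y. G (t + y\<^sup>2) \<partial>lborel)" for t
  have H: "H \<in> borel_measurable borel"
    unfolding H_def by measurable
  note IH = Suc.IH[OF pos_def_schur_compl[OF Suc.prems(1)] H]
  let ?D = "det (mat n n (\<lambda>(i, j). schur_compl n a i j))"
  have det: "det (mat (Suc n) (Suc n) (\<lambda>(i, j). a i j)) = a n n * ?D"
    using pos by (intro det_schur_compl) simp
  \<comment> \<open>Affine substitution in coordinate \<open>n\<close>, used with
    \<open>c = s\<close> for the form itself and with \<open>c = 1\<close> for the sum of
    squares.\<close>
  have slice: "(\<integral>\<^sup>+x. G (q x) \<partial>?M (Suc n)) = ennreal (1 / c) * (\<integral>\<^sup>+x. H (p x) \<partial>?M n)"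
    if [measurable]: "q \<in> borel_measurable (?M (Suc n))" "p \<in> borel_measurable (?M n)"
      and c: "c > 0" and q: "\<And>x y. q (x(n := y)) = p x + (c * y + r x)\<^sup>2" for q p c r
  proof -
    have [measurable]: "q \<in> borel_measurable (PiM (insert n {..<n}) (\<lambda>_. lborel))"
      using that(1) by (simp add: ins)
    have "(\<integral>\<^sup>+x. G (q x) \<partial>?M (Suc n)) = (\<integral>\<^sup>+x. \<integral>\<^sup>+y. G (q (x(n := y))) \<partial>lborel \<partial>?M n)"
      unfolding ins by (rule product_nn_integral_insert) auto
    also have "\<dots> = (\<integral>\<^sup>+x. ennreal (1 / c) * H (p x) \<partial>?M n)"
    proof (rule nn_integral_cong)
      fix x
      have "H (p x) = ennreal c * (\<integral>\<^sup>+y. G (p x + (r x + c * y)\<^sup>2) \<partial>lborel)"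
        unfolding H_def using c
        by (subst nn_integral_real_affine[where c = c and t = "r x"]) auto
      then show "(\<integral>\<^sup>+y. G (q (x(n := y))) \<partial>lborel) = ennreal (1 / c) * H (p x)"
        using c by (simp add: q add.commute mult.assoc[symmetric] ennreal_mult[symmetric])
    qed
    also have "\<dots> = ennreal (1 / c) * (\<integral>\<^sup>+x. H (p x) \<partial>?M n)"
      by (intro nn_integral_cmult measurable_compose[OF _ H]) simp
    finally show ?thesis .
  qed
  have "(\<integral>\<^sup>+x. G (quad_form (Suc n) a x) \<partial>?M (Suc n)) =
    ennreal (1 / s) * (\<integral>\<^sup>+x. H (quad_form n (schur_compl n a) x) \<partial>?M n)"
  proof (rule slice)
    fix x y
    have "(\<Sum>i<n. a i n * (x(n := y)) i) = (\<Sum>i<n. a i n * x i)"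
      by (intro sum.cong) auto
    moreover have "quad_form n (schur_compl n a) (x(n := y)) = quad_form n (schur_compl n a) x"
      by (rule quad_form_cong) simp
    ultimately show "quad_form (Suc n) a (x(n := y)) =
        quad_form n (schur_compl n a) x + (s * y + (\<Sum>i<n. a i n * x i) / s)\<^sup>2"
      unfolding quad_form_schur_compl[of a, OF sym pos] by (simp add: s_def)
  qed (use s in \<open>auto simp: quad_form_def\<close>)
  also have "\<dots> = ennreal (1 / s) * ennreal (1 / sqrt ?D) * (\<integral>\<^sup>+x. H (\<Sum>i<n. (x i)\<^sup>2) \<partial>?M n)"
    using IH by (simp add: mult.assoc)
  also have "ennreal (1 / s) * ennreal (1 / sqrt ?D) = ennreal (1 / sqrt (a n n * ?D))"
    using s IH by (subst ennreal_mult[symmetric]) (auto simp: s_def real_sqrt_mult)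
  also have "(\<integral>\<^sup>+x. H (\<Sum>i<n. (x i)\<^sup>2) \<partial>?M n) = (\<integral>\<^sup>+x. G (\<Sum>i<Suc n. (x i)\<^sup>2) \<partial>?M (Suc n))"
    using slice[of "\<lambda>x. \<Sum>i<Suc n. (x i)\<^sup>2" "\<lambda>x. \<Sum>i<n. (x i)\<^sup>2" 1 "\<lambda>_. 0"] by simp
  finally show ?case
    using IH pos by (simp add: det)
qed

text \<open>Layer by layer: the region where the integrand is at least \<open>t\<close> is a ball of
  radius \<open>sqrt (s * (1 - t))\<close> in even dimension, of volume
  \<open>pi ^ m / fact m * (s * (1 - t)) ^ m\<close>. Integrating over \<open>t\<close> from 0 to 1
  contributes the factor 1 / (m + 1).\<close>

lemma nn_integral_paraboloid:
  assumes "s > 0"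
  shows "(\<integral>\<^sup>+x. ennreal (1 - (\<Sum>i<2*m. (x i)\<^sup>2) / s) \<partial>PiM {..<2*m} (\<lambda>_. lborel)) =
    ennreal ((pi * s) ^ m / fact (Suc m))"
proof -
  interpret product_sigma_finite "\<lambda>_::nat. lborel :: real measure"
    by standard
  let ?M = "PiM {..<2*m} (\<lambda>_. lborel :: real measure)"
  let ?q = "\<lambda>x::nat \<Rightarrow> real. \<Sum>i<2*m. (x i)\<^sup>2"
  have pf: "pair_sigma_finite ?M (lborel :: real measure)"
    by (simp add: sigma_finite pair_sigma_finite.intro sigma_finite_measures)
  have "(\<integral>\<^sup>+x. ennreal (1 - ?q x / s) \<partial>?M) =
    (\<integral>\<^sup>+x. \<integral>\<^sup>+t. indicator {0..1} t * (if ?q x \<le> s * (1 - t) then 1 else 0) \<partial>lborel \<partial>?M)"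
  proof (rule nn_integral_cong)
    fix x :: "nat \<Rightarrow> real"
    have "?q x \<ge> 0" by (simp add: sum_nonneg)
    have "(\<integral>\<^sup>+t. indicator {0..1} t * (if ?q x \<le> s * (1 - t) then 1 else 0) \<partial>lborel) =
      (\<integral>\<^sup>+t. indicator {0..1 - ?q x / s} t \<partial>lborel)"
    proof (rule nn_integral_cong)
      fix t
      have "?q x / s \<ge> 0" "?q x \<le> s * (1 - t) \<longleftrightarrow> t \<le> 1 - ?q x / s"
        using assms \<open>?q x \<ge> 0\<close> by (auto simp: field_simps)
      then show "indicator {0..1} t * (if ?q x \<le> s * (1 - t) then 1 else 0) = (indicator {0..1 - ?q x / s} t :: ennreal)"
        by (auto simp: indicator_def)
    qed
    then show "ennreal (1 - ?q x / s) =
      (\<integral>\<^sup>+t. indicator {0..1} t * (if ?q x \<le> s * (1 - t) then 1 else 0) \<partial>lborel)"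
      by (simp add: emeasure_lborel_Icc_eq ennreal_neg)
  qed
  also have "\<dots> = (\<integral>\<^sup>+t. \<integral>\<^sup>+x. indicator {0..1} t * (if ?q x \<le> s * (1 - t) then 1 else 0) \<partial>?M \<partial>lborel)"
    by (rule pair_sigma_finite.Fubini'[OF pf, symmetric]) measurable
  also have "\<dots> = (\<integral>\<^sup>+t. ennreal (pi ^ m / fact m * s ^ m * (1 - t) ^ m) * indicator {0..1} t \<partial>lborel)"
  proof (rule nn_integral_cong_AE)
    \<comment> \<open>The volume formula is applied to balls of positive radius only; the null set t
      = 1 is discarded.\<close>
    have "AE t::real in lborel. t \<noteq> 1"
      by (rule AE_lborel_singleton)
    then show "AE t in lborel. (\<integral>\<^sup>+x. indicator {0..1} t * (if ?q x \<le> s * (1 - t) then 1 else 0) \<partial>?M) =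
      ennreal (pi ^ m / fact m * s ^ m * (1 - t) ^ m) * indicator {0..1} t"
    proof eventually_elim
      case (elim t)
      show ?case
      proof (cases "0 \<le> t \<and> t < 1")
        case True
        then have r: "s * (1 - t) > 0" using assms by simp
        have "(\<integral>\<^sup>+x. (if ?q x \<le> s * (1 - t) then 1 else 0) \<partial>?M) =
          (\<integral>\<^sup>+x. indicator ({x. sqrt (?q x) \<le> sqrt (s * (1 - t))} \<inter> space ?M) x \<partial>?M)"
          by (intro nn_integral_cong) (auto simp: indicator_def)
        also have "\<dots> = emeasure ?M ({x. sqrt (?q x) \<le> sqrt (s * (1 - t))} \<inter> space ?M)"
          by (rule nn_integral_indicator) auto
        also have "\<dots> = ennreal (unit_ball_vol (real (2 * m)) * sqrt (s * (1 - t)) ^ (2 * m))"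
          using r by (subst emeasure_cball_aux) auto
        also have "sqrt (s * (1 - t)) ^ (2 * m) = s ^ m * (1 - t) ^ m"
          using r by (simp add: power_mult power_mult_distrib)
        also have "unit_ball_vol (real (2 * m)) = pi ^ m / fact m"
          by (rule unit_ball_vol_even)
        finally show ?thesis using True by (simp add: mult.assoc)
      qed (use elim in \<open>auto simp: indicator_def\<close>)
    qed
  qed
  also have "\<dots> = ennreal (0 - (- (pi ^ m / fact m * s ^ m / Suc m)))"
  proof -
    define C where "C = pi ^ m / fact m * s ^ m"
    have C: "C \<ge> 0" using assms by (simp add: C_def)
    have "((\<lambda>t. - (C / Suc m * (1 - t) ^ Suc m)) has_real_derivative C * (1 - t) ^ m) (at t)" for t
    proof -
      have "((\<lambda>t. - (C / Suc m * (1 - t) ^ Suc m)) has_real_derivative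
          - (C / Suc m * (real (Suc m) * (1 - t) ^ m * (0 - 1)))) (at t)"
        by (rule derivative_eq_intros refl | simp)+
      then show ?thesis by simp
    qed
    then have "(\<integral>\<^sup>+t. ennreal (C * (1 - t) ^ m) * indicator {0..1} t \<partial>lborel) =
        ennreal (- (C / Suc m * (1 - 1) ^ Suc m) - - (C / Suc m * (1 - 0) ^ Suc m))"
      using C by (intro nn_integral_FTC_Icc) auto
    then show ?thesis by (simp add: C_def)
  qed
  also have "0 - (- (pi ^ m / fact m * s ^ m / Suc m)) = (pi * s) ^ m / fact (Suc m)"
    by (simp add: power_mult_distrib field_simps)
  finally show ?thesis .
qed

section \<open>Blichfeldt's bound\<close>

text \<open>Over ordered pairs, the values Q(y_p - y_q) sum to 2 k times the sum of the Q(y_p),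
  minus twice Q at the sum of the y_p, where k is \<open>card S\<close>. The subtracted term is
  nonnegative and is dropped.\<close>

lemma blichfeldt_sum_le:
  fixes y :: "'b \<Rightarrow> nat \<Rightarrow> real"
  assumes pd: "pos_def n a" and S: "finite S"
    and sep: "\<And>p q. p \<in> S \<Longrightarrow> q \<in> S \<Longrightarrow> p \<noteq> q \<Longrightarrow> quad_form n a (\<lambda>i. y p i - y q i) \<ge> d"
  shows "d * (real (card S) - 1) * card S \<le> 2 * card S * (\<Sum>p\<in>S. quad_form n a (y p))"
proof -
  have sym: "a i j = a j i" for i j
    using pd by (simp add: pos_def_def)
  let ?Q = "quad_form n a"
  let ?t = "\<lambda>i. \<Sum>p\<in>S. y p i"
  have "d * (real (card S) - 1) * card S = (\<Sum>p\<in>S. \<Sum>q\<in>S. if p = q then 0 else d)"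
  proof -
    have "(\<Sum>q\<in>S. if p = q then 0 else d) = d * (real (card S) - 1)" if "p \<in> S" for p
    proof -
      have "card S > 0" using S that by (auto simp: card_gt_0_iff)
      have "(\<Sum>q\<in>S. if p = q then 0 else d) = (\<Sum>q\<in>S - {p}. d)"
        by (rule sum.mono_neutral_cong_right) (use S in auto)
      then show ?thesis
        using \<open>card S > 0\<close> that by (simp add: card_Diff_singleton of_nat_diff Suc_leI mult.commute)
    qed
    then show ?thesis by simp
  qed
  also have "\<dots> \<le> (\<Sum>p\<in>S. \<Sum>q\<in>S. ?Q (\<lambda>i. y p i - y q i))"
    using sep by (intro sum_mono) (auto simp: quad_form_def)
  also have "\<dots> = 2 * card S * (\<Sum>p\<in>S. ?Q (y p)) - 2 * (\<Sum>p\<in>S. \<Sum>q\<in>S. \<Sum>i<n. \<Sum>j<n. a i j * y p i * y q j)"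
    by (simp add: quad_form_diff[of a, OF sym] bilin_def sum_subtractf sum.distrib flip: sum_distrib_left)
  also have "(\<Sum>p\<in>S. \<Sum>q\<in>S. \<Sum>i<n. \<Sum>j<n. a i j * y p i * y q j) = ?Q ?t"
  proof -
    have "(\<Sum>p\<in>S. \<Sum>q\<in>S. \<Sum>i<n. \<Sum>j<n. a i j * y p i * y q j) =
      (\<Sum>p\<in>S. \<Sum>i<n. \<Sum>q\<in>S. \<Sum>j<n. a i j * y p i * y q j)"
      by (intro sum.cong refl sum.swap)
    also have "\<dots> = (\<Sum>i<n. \<Sum>p\<in>S. \<Sum>q\<in>S. \<Sum>j<n. a i j * y p i * y q j)"
      by (rule sum.swap)
    also have "\<dots> = (\<Sum>i<n. \<Sum>p\<in>S. \<Sum>j<n. \<Sum>q\<in>S. a i j * y p i * y q j)"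
      by (intro sum.cong refl sum.swap)
    also have "\<dots> = (\<Sum>i<n. \<Sum>j<n. \<Sum>p\<in>S. \<Sum>q\<in>S. a i j * y p i * y q j)"
      by (intro sum.cong refl sum.swap)
    also have "\<dots> = ?Q ?t"
      unfolding quad_form_def
      by (intro sum.cong refl, subst sum.swap) (simp add: sum_distrib_left sum_distrib_right mult.assoc)
    finally show ?thesis .
  qed
  also have "2 * card S * (\<Sum>p\<in>S. ?Q (y p)) - 2 * ?Q ?t \<le> 2 * card S * (\<Sum>p\<in>S. ?Q (y p))"
    using pos_def_nonneg[OF pd, of ?t] by simp
  finally show ?thesis .
qed

text \<open>The integer translates of the truncated paraboloid \<open>F\<close> add up to at most 1,
  so its integral is at most 1. That integral is evaluated by \<open>nn_integral_quad_form\<close>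
  and by \<open>nn_integral_paraboloid\<close> with \<open>s = d / 2\<close>.\<close>

theorem blichfeldt_bound:
  assumes pd: "pos_def (2 * m) a" and d: "d > 0"
    and min: "\<And>l::nat \<Rightarrow> int. \<exists>i<2*m. l i \<noteq> 0 \<Longrightarrow> quad_form (2 * m) a (\<lambda>i. of_int (l i)) \<ge> d"
  shows "(pi * d / 2) ^ m / fact (Suc m) \<le> sqrt (det (mat (2 * m) (2 * m) (\<lambda>(i, j). a i j)))"
proof -
  let ?n = "2 * m" and ?Q = "quad_form (2 * m) a" and ?M = "PiM {..<2 * m} (\<lambda>_. lborel :: real measure)"
  let ?D = "det (mat (2 * m) (2 * m) (\<lambda>(i, j). a i j))"
  \<comment> \<open>\<open>ennreal\<close> truncates negative reals to 0.\<close>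
  define F where "F x = ennreal (1 - ?Q x / (d / 2))" for x
  have "(\<integral>\<^sup>+x. F x \<partial>?M) \<le> 1"
  proof (rule nn_integral_PiM_le_one)
    show "F \<in> borel_measurable ?M"
      unfolding F_def quad_form_def by measurable
  next
    fix x :: "nat \<Rightarrow> real" and S :: "(nat \<Rightarrow> int) set"
    assume S: "finite S" and l0: "\<And>l i. l \<in> S \<Longrightarrow> ?n \<le> i \<Longrightarrow> l i = 0"
    define y where "y l i = x i + of_int (l i)" for l :: "nat \<Rightarrow> int" and i
    \<comment> \<open>Only translates with a positive value contribute; on \<open>T\<close> no
      truncation occurs, so the sum can be computed in the reals.\<close>
    define T where "T = {l \<in> S. 1 - ?Q (y l) / (d / 2) > 0}"
    have T: "finite T" "T \<subseteq> S" using S by (auto simp: T_def)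
    have "(\<Sum>l\<in>S. F (\<lambda>i. x i + of_int (l i))) = (\<Sum>l\<in>T. F (y l))"
      unfolding y_def[symmetric, abs_def]
    proof (rule sum.mono_neutral_right)
      have "F (y l) = 0" if "l \<in> S - T" for l
        unfolding F_def by (rule ennreal_neg) (use that in \<open>simp add: T_def not_less\<close>)
      then show "\<forall>l\<in>S - T. F (y l) = 0" by blast
    qed (use S T in auto)
    also have "\<dots> = ennreal (\<Sum>l\<in>T. 1 - ?Q (y l) / (d / 2))"
      unfolding F_def by (rule sum_ennreal) (simp add: T_def)
    finally have eq: "(\<Sum>l\<in>S. F (\<lambda>i. x i + of_int (l i))) = \<dots>" .
    have "(\<Sum>l\<in>T. 1 - ?Q (y l) / (d / 2)) \<le> 1"
    proof (cases "T = {}")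
      case False
      have "d * (real (card T) - 1) * card T \<le> 2 * card T * (\<Sum>p\<in>T. ?Q (y p))"
      proof (rule blichfeldt_sum_le[OF pd T(1)])
        fix p q assume pq: "p \<in> T" "q \<in> T" "p \<noteq> q"
        then obtain i where i: "p i \<noteq> q i" by auto
        moreover have "p \<in> S" "q \<in> S" using pq T by auto
        \<comment> \<open>All vectors of \<open>S\<close> vanish from \<open>?n\<close> on, so two
          distinct ones differ at a coordinate that the form sees.\<close>
        ultimately have "i < ?n" using l0[of p i] l0[of q i] by (cases "i < ?n") auto
        with i have "\<exists>i<?n. p i - q i \<noteq> 0" by auto
        from min[of "\<lambda>i. p i - q i", OF this]
        show "d \<le> ?Q (\<lambda>i. y p i - y q i)" by (simp add: y_def)
      qed
      moreover have "card T > 0" using False T by (simp add: card_gt_0_iff)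
      ultimately have "d * (real (card T) - 1) \<le> 2 * (\<Sum>p\<in>T. ?Q (y p))"
        by (simp add: mult.commute mult.left_commute)
      \<comment> \<open>With k for \<open>card T\<close>, the values \<open>?Q (y p)\<close> times 2
        / d sum to at least k - 1, which leaves at most k - (k - 1) = 1.\<close>
      then show ?thesis
        using d by (simp add: sum_subtractf field_simps flip: sum_divide_distrib sum_distrib_left)
    qed simp
    then show "(\<Sum>l\<in>S. F (\<lambda>i. x i + of_int (l i))) \<le> 1"
      unfolding eq by (simp add: ennreal_le_1)
  qed
  moreover have det: "?D > 0" and "(\<integral>\<^sup>+x. F x \<partial>?M) =
      ennreal (1 / sqrt ?D) * (\<integral>\<^sup>+x. ennreal (1 - (\<Sum>i<2*m. (x i)\<^sup>2) / (d / 2)) \<partial>?M)"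
    using nn_integral_quad_form[OF pd, of "\<lambda>q. ennreal (1 - q / (d / 2))"] unfolding F_def by auto
  moreover have "ennreal (1 / sqrt ?D) * (\<integral>\<^sup>+x. ennreal (1 - (\<Sum>i<2*m. (x i)\<^sup>2) / (d / 2)) \<partial>?M) =
      ennreal ((pi * d / 2) ^ m / fact (Suc m) / sqrt ?D)"
    using nn_integral_paraboloid[of "d / 2" m] d det by (simp add: ennreal_mult[symmetric] del: fact_Suc)
  ultimately have "(pi * d / 2) ^ m / fact (Suc m) / sqrt ?D \<le> 1"
    by (simp add: ennreal_le_1 del: fact_Suc)
  then show ?thesis
    using det by (simp add: field_simps del: fact_Suc)
qed

section \<open>The numerical inequality between factorials and powers\<close>

text \<open>The binomial expansion cut after the cubic term. In the induction step the surplus is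
  the nonnegative quartic term.\<close>

lemma power_ge_cubic_binomial:
  fixes h :: real
  assumes "h \<ge> 0"
  shows "(1 + h) ^ m \<ge> 1 + m * h + m * (real m - 1) / 2 * h\<^sup>2 + m * (real m - 1) * (real m - 2) / 6 * h ^ 3"
proof (induction m)
  case 0
  show ?case by simp
next
  case (Suc m)
  have "real m * (real m - 1) * (real m - 2) \<ge> 0"
  proof (cases "m < 2")
    case True
    then show ?thesis by (cases m) auto
  qed simp
  then have "m * (real m - 1) * (real m - 2) / 6 * h ^ 4 \<ge> 0"
    by simp
  moreover have "(1 + h) * (1 + m * h + m * (real m - 1) / 2 * h\<^sup>2 + m * (real m - 1) * (real m - 2) / 6 * h ^ 3)
      \<le> (1 + h) ^ Suc m"
    using Suc.IH assms by (simp add: mult_left_mono)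
  ultimately show ?case
    by (simp add: field_simps power2_eq_square power3_eq_cube power4_eq_xxxx)
qed

text \<open>Compares the growth of both sides of \<open>fact_less_blichfeldt\<close> from
  \<open>m\<close> to \<open>Suc m\<close>. As m grows, the power tends to e, and pi e / 8 > 1.
  Three binomial terms would only give 5/2, and 3.14 / 8 * 5/2 < 1; the cubic term raises this to
  8/3, which suffices.\<close>

lemma blichfeldt_step:
  "real m + 2 \<le> pi / 8 * (real m + 7) * (1 + 1 / (real m + 6)) ^ m"
proof -
  define x where "x = real m"
  define h where "h = 1 / (x + 6)"
  have x: "x \<ge> 0" by (simp add: x_def)
  define p where "p = 1 + x * h + x * (x - 1) / 2 * h\<^sup>2 + x * (x - 1) * (x - 2) / 6 * h ^ 3"
  have hx: "h * (x + 6) = 1"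
    using x by (simp add: h_def)
  have "p * (6 * (x + 6) ^ 3) = 6 * (x + 6) ^ 3 + 6 * x * (h * (x + 6)) * (x + 6)\<^sup>2 +
      3 * x * (x - 1) * (h * (x + 6))\<^sup>2 * (x + 6) + x * (x - 1) * (x - 2) * (h * (x + 6)) ^ 3"
    by (simp add: p_def field_simps power2_eq_square power3_eq_cube)
  then have p: "p * (6 * (x + 6) ^ 3) =
      6 * (x + 6) ^ 3 + 6 * x * (x + 6)\<^sup>2 + 3 * x * (x - 1) * (x + 6) + x * (x - 1) * (x - 2)"
    unfolding hx by simp
  \<comment> \<open>The constant 314 / 800 is 3.14 / 8, a lower bound for pi / 8; the factor
    \<open>6 * (x + 6) ^ 3\<close> clears the denominators of \<open>p\<close>.\<close>
  have "(x + 2) * (6 * (x + 6) ^ 3) \<le> 314 / 800 * (x + 7) * (p * (6 * (x + 6) ^ 3))"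
  proof -
    \<comment> \<open>The difference is a polynomial in \<open>x\<close>, written so that every
      summand is visibly nonnegative for x \<ge> 0.\<close>
    have "314 / 800 * (x + 7) * (p * (6 * (x + 6) ^ 3)) - (x + 2) * (6 * (x + 6) ^ 3) =
        7 / 25 * (x\<^sup>2 * (x - 2)\<^sup>2) + 11 / 25 * (x * (x - 6)\<^sup>2) + 13 / 25 * x\<^sup>2 + 5768 / 25 * x + 24219 / 25"
      unfolding p by (simp add: field_simps power2_eq_square power3_eq_cube)
    also have "\<dots> \<ge> 0" using x by (intro add_nonneg_nonneg) simp_all
    finally show ?thesis by simp
  qed
  then have "(x + 2) * (6 * (x + 6) ^ 3) \<le> (314 / 800 * (x + 7) * p) * (6 * (x + 6) ^ 3)"
    by (simp only: mult.assoc)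
  then have "x + 2 \<le> 314 / 800 * (x + 7) * p"
    by (rule mult_right_le_imp_le) (use x in simp)
  also have "\<dots> \<le> 314 / 800 * (x + 7) * (1 + h) ^ m"
    using power_ge_cubic_binomial[of h m] x unfolding p_def x_def[symmetric]
    by (intro mult_left_mono) (auto simp: h_def)
  also have "\<dots> \<le> pi / 8 * (x + 7) * (1 + h) ^ m"
    using pi_approx x by (intro mult_right_mono) (auto simp: h_def)
  finally show ?thesis by (simp add: x_def h_def)
qed

lemma fact_less_blichfeldt:
  assumes "m \<ge> 2"
  shows "fact (Suc m) < (pi * (real m + 6) / 8) ^ m"
  using assms
proof (induction m rule: dec_induct)
  case base
  \<comment> \<open>At m = 2 the claim reads 6 < pi^2.\<close>
  have "3 * 3 < pi * pi"
    using pi_approx by (intro mult_strict_mono) auto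
  then show ?case by (simp add: fact_numeral power2_eq_square numeral_2_eq_2)
next
  case (step m)
  have "fact (Suc (Suc m)) = (real m + 2) * fact (Suc m)"
    by (simp add: algebra_simps)
  also have "\<dots> < (real m + 2) * (pi * (real m + 6) / 8) ^ m"
    using step.IH by (intro mult_strict_left_mono) auto
  also have "\<dots> \<le> (pi / 8 * (real m + 7) * (1 + 1 / (real m + 6)) ^ m) * (pi * (real m + 6) / 8) ^ m"
    using blichfeldt_step[of m] by (intro mult_right_mono) (auto simp: add.commute)
  also have "\<dots> = pi / 8 * (real m + 7) * ((1 + 1 / (real m + 6)) * (pi * (real m + 6) / 8)) ^ m"
    by (simp only: power_mult_distrib mult.assoc)
  also have "\<dots> = (pi * (real (Suc m) + 6) / 8) ^ Suc m"
  proof -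
    have eq: "(1 + 1 / (real m + 6)) * (pi * (real m + 6) / 8) = pi * (real (Suc m) + 6) / 8"
      by (simp add: field_simps)
    show ?thesis unfolding eq by (simp add: algebra_simps)
  qed
  finally show ?case .
qed

section \<open>Positive definiteness from eigenvalues\<close>

text \<open>The usual discriminant argument, stated for semidefinite forms because it is applied to
  A - \<mu> I at the infimum \<mu> of the Rayleigh quotient. Vectors \<open>y\<close> on which the
  form vanishes are treated apart.\<close>

lemma bilin_cauchy_schwarz:
  fixes a :: "nat \<Rightarrow> nat \<Rightarrow> real"
  assumes sym: "\<And>i j. a i j = a j i" and nonneg: "\<And>x. quad_form n a x \<ge> 0"
  shows "(bilin n a x y)\<^sup>2 \<le> quad_form n a x * quad_form n a y"
proof -
  let ?q = "quad_form n a" and ?b = "bilin n a x y"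
  have comm: "bilin n a y x = ?b"
    unfolding bilin_def by (subst sum.swap) (intro sum.cong refl, subst sym, simp)
  have expand: "?q x - 2 * t * ?b + t\<^sup>2 * ?q y \<ge> 0" for t
  proof -
    have "?q (\<lambda>i. x i - t * y i) = ?q x - t * ?b - t * bilin n a y x + t\<^sup>2 * ?q y"
      by (simp add: quad_form_def bilin_def algebra_simps sum.distrib sum_subtractf sum_distrib_left power2_eq_square)
    then show ?thesis
      using nonneg[of "\<lambda>i. x i - t * y i"] by (simp add: comm)
  qed
  show ?thesis
  proof (cases "?q y = 0")
    case True
    have "?b = 0"
    proof (rule ccontr)
      assume "?b \<noteq> 0"
      \<comment> \<open>For this \<open>t\<close> the expression in \<open>expand\<close> equals
        -1.\<close>
      then show False
        using expand[of "(?q x + 1) / (2 * ?b)"] True by simp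
    qed
    then show ?thesis using True by simp
  next
    case False
    then have "?q y > 0" using nonneg[of y] by simp
    then show ?thesis
      using expand[of "?b / ?q y"] by (simp add: field_simps power2_eq_square)
  qed
qed

text \<open>Coordinates of a unit vector have absolute value at most 1. The bound makes the Rayleigh
  quotient bounded below and also controls the form of the inverse matrix.\<close>

lemma abs_quad_form_le:
  fixes a :: "nat \<Rightarrow> nat \<Rightarrow> real"
  assumes "(\<Sum>i<n. (x i)\<^sup>2) = 1"
  shows "\<bar>quad_form n a x\<bar> \<le> (\<Sum>i<n. \<Sum>j<n. \<bar>a i j\<bar>)"
proof -
  have x: "\<bar>x i\<bar> \<le> 1" if "i < n" for i
  proof -
    have "(x i)\<^sup>2 \<le> (\<Sum>i<n. (x i)\<^sup>2)"
      using that by (intro member_le_sum) auto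
    then show ?thesis using assms by (simp add: abs_square_le_1)
  qed
  have "\<bar>quad_form n a x\<bar> \<le> (\<Sum>i<n. \<bar>\<Sum>j<n. a i j * x i * x j\<bar>)"
    unfolding quad_form_def by (rule sum_abs)
  also have "\<dots> \<le> (\<Sum>i<n. \<Sum>j<n. \<bar>a i j * x i * x j\<bar>)"
    by (intro sum_mono sum_abs)
  also have "\<dots> \<le> (\<Sum>i<n. \<Sum>j<n. \<bar>a i j\<bar>)"
  proof (intro sum_mono)
    fix i j assume "i \<in> {..<n}" "j \<in> {..<n}"
    then have "\<bar>x i\<bar> * \<bar>x j\<bar> \<le> 1"
      using x by (intro mult_le_one) auto
    then have "\<bar>a i j\<bar> * (\<bar>x i\<bar> * \<bar>x j\<bar>) \<le> \<bar>a i j\<bar> * 1"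
      by (intro mult_left_mono) auto
    then show "\<bar>a i j * x i * x j\<bar> \<le> \<bar>a i j\<bar>" by (simp add: abs_mult mult.assoc)
  qed
  finally show ?thesis .
qed

text \<open>The infimum \<open>\<mu>\<close> of the Rayleigh quotient is an eigenvalue: otherwise \<open>A - \<mu>I\<close> would have an
  inverse \<open>W\<close>, and Cauchy-Schwarz for \<open>x\<close> and \<open>W x\<close> would bound the form of \<open>A - \<mu>I\<close> away from 0
  on the unit sphere.\<close>
lemma pos_def_of_eigenvalues:
  fixes a :: "nat \<Rightarrow> nat \<Rightarrow> real"
  defines "A \<equiv> \<lambda>n. mat n n (\<lambda>(i, j). a i j)"
  assumes sym: "\<And>i j. a i j = a j i" and ev: "\<And>k. eigenvalue (A n) k \<Longrightarrow> k > 0"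
  shows "pos_def n a"
proof (cases "n = 0")
  \<comment> \<open>In dimension 0 the unit sphere is empty, so the infimum below would say
    nothing.\<close>
  case True
  then show ?thesis using sym by (auto simp: pos_def_def)
next
  case False
  let ?N = "\<lambda>x::nat \<Rightarrow> real. \<Sum>i<n. (x i)\<^sup>2"
  let ?S = "{x. ?N x = 1}"
  define mu where "mu = (INF x\<in>?S. quad_form n a x)"
  have ne: "?S \<noteq> {}"
  proof -
    have "?N (\<lambda>i. if i = 0 then 1 else 0) = (\<Sum>i<n. if i = 0 then 1 else 0)"
      by (rule sum.cong) auto
    then have "?N (\<lambda>i. if i = 0 then 1 else 0) = 1"
      using False by simp
    then have "(\<lambda>i. if i = 0 then 1 else 0) \<in> ?S"
      by (simp only: mem_Collect_eq)
    then show ?thesis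
      by (rule ex_in_conv[THEN iffD1, OF exI])
  qed
  have bdd: "bdd_below (quad_form n a ` ?S)"
  proof (rule bdd_belowI2)
    fix x assume "x \<in> ?S"
    then show "- (\<Sum>i<n. \<Sum>j<n. \<bar>a i j\<bar>) \<le> quad_form n a x"
      using abs_quad_form_le[of x n a] by (simp add: abs_le_iff)
  qed
  have mu_le: "mu * ?N x \<le> quad_form n a x" for x
  proof (cases "?N x = 0")
    case True
    then have "x i = 0" if "i < n" for i
      using that by (simp add: sum_nonneg_eq_0_iff)
    then show ?thesis using True by (simp add: quad_form_def)
  next
    case False
    define c where "c = 1 / sqrt (?N x)"
    have "?N x > 0" using False sum_nonneg[of "{..<n}" "\<lambda>i. (x i)\<^sup>2"] by auto
    then have c: "c\<^sup>2 * ?N x = 1" by (simp add: c_def power_divide)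
    then have "?N (\<lambda>i. c * x i) = 1"
      by (simp add: power_mult_distrib flip: sum_distrib_left)
    then have "mu \<le> quad_form n a (\<lambda>i. c * x i)"
      unfolding mu_def by (intro cINF_lower[OF bdd]) auto
    also have "\<dots> = c\<^sup>2 * quad_form n a x" by (rule quad_form_scale)
    finally have "mu * ?N x \<le> c\<^sup>2 * quad_form n a x * ?N x"
      using \<open>?N x > 0\<close> by (intro mult_right_mono) auto
    also have "\<dots> = (c\<^sup>2 * ?N x) * quad_form n a x" by (simp only: ac_simps)
    finally show ?thesis using c by simp
  qed
  \<comment> \<open>The coefficients of A - \<mu> I, whose form is nonnegative by
    \<open>mu_le\<close>.\<close>
  define b where "b i j = a i j - (if i = j then mu else 0)" for i j
  have b_form: "quad_form n b x = quad_form n a x - mu * ?N x" for x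
  proof -
    have "(\<Sum>j<n. b i j * x i * x j) = (\<Sum>j<n. a i j * x i * x j) - mu * (x i)\<^sup>2" if "i < n" for i
      using that by (simp add: b_def left_diff_distrib sum_subtractf if_distrib[of "\<lambda>c. c * _"] power2_eq_square mult.assoc cong: if_cong)
    then show ?thesis by (simp add: quad_form_def sum_subtractf sum_distrib_left)
  qed
  have b_sym: "b i j = b j i" for i j
    unfolding b_def sym[of i j] by simp
  let ?B = "mat n n (\<lambda>(i, j). b i j)"
  have "det ?B = 0"
  proof (rule ccontr)
    assume "det ?B \<noteq> 0"
    then obtain W where W: "W \<in> carrier_mat n n" "?B * W = 1\<^sub>m n"
      using det_non_zero_imp_unit[of ?B n] by (auto simp: Units_def ring_mat_def)
    define K where "K = (\<Sum>i<n. \<Sum>j<n. \<bar>W $$ (i, j)\<bar>)"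
    \<comment> \<open>With z = W x one has \<open>bilin n b x z = 1\<close>, and the form of
      \<open>b\<close> at \<open>z\<close> equals the form of \<open>W\<close> at \<open>x\<close>,
      hence is at most \<open>K\<close>. Cauchy-Schwarz then gives the claim.\<close>
    have key: "1 \<le> quad_form n b x * K" if x: "?N x = 1" for x
    proof -
      define z where "z i = (\<Sum>j<n. W $$ (i, j) * x j)" for i
      have bz: "(\<Sum>j<n. b i j * z j) = x i" if i: "i < n" for i
      proof -
        have inv: "(\<Sum>j<n. b i j * W $$ (j, k)) = (if i = k then 1 else 0)" if "k < n" for k
        proof -
          have "(?B * W) $$ (i, k) = (\<Sum>j = 0..<n. b i j * W $$ (j, k))"
            using W(1) i that by (simp add: scalar_prod_def)
          then show ?thesis using i that W(2) by (simp add: lessThan_atLeast0)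
        qed
        have "(\<Sum>j<n. b i j * z j) = (\<Sum>j<n. \<Sum>k<n. b i j * W $$ (j, k) * x k)"
          by (simp add: z_def sum_distrib_left mult.assoc)
        also have "\<dots> = (\<Sum>k<n. (\<Sum>j<n. b i j * W $$ (j, k)) * x k)"
          unfolding sum_distrib_right by (rule sum.swap)
        also have "\<dots> = (\<Sum>k<n. if i = k then x k else 0)"
          by (rule sum.cong) (simp_all add: inv)
        also have "\<dots> = x i" using i by simp
        finally show ?thesis .
      qed
      have bilin_z: "bilin n b y z = (\<Sum>i<n. y i * x i)" for y
      proof -
        have "bilin n b y z = (\<Sum>i<n. y i * (\<Sum>j<n. b i j * z j))"
          by (simp add: bilin_def sum_distrib_left mult_ac)
        then show ?thesis using bz by simp
      qed
      have "quad_form n b z = (\<Sum>i<n. z i * x i)"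
        using bilin_z[of z] by (simp add: bilin_def quad_form_def)
      also have "\<dots> = quad_form n (\<lambda>i j. W $$ (i, j)) x"
        by (simp add: z_def quad_form_def sum_distrib_left mult_ac)
      also have "\<dots> \<le> K"
        using abs_quad_form_le[OF x, of "\<lambda>i j. W $$ (i, j)"] by (simp add: K_def)
      finally have "quad_form n b z \<le> K" .
      moreover have "quad_form n b x \<ge> 0" "bilin n b x z = 1"
        using mu_le[of x] x by (simp_all add: b_form bilin_z power2_eq_square)
      moreover have "(bilin n b x z)\<^sup>2 \<le> quad_form n b x * quad_form n b z"
        using mu_le by (intro bilin_cauchy_schwarz b_sym) (simp add: b_form)
      ultimately show ?thesis
        using mult_left_mono[of "quad_form n b z" K "quad_form n b x"] by simp
    qed
    have "K > 0"
    proof -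
      obtain x where "?N x = 1" using ne by blast
      then have "1 \<le> quad_form n b x * K" by (rule key)
      moreover have "K \<ge> 0" by (simp add: K_def sum_nonneg)
      ultimately show ?thesis by (cases "K = 0") auto
    qed
    \<comment> \<open>By \<open>key\<close>, \<open>mu + 1 / K\<close> would still be a lower bound
      of the form on the unit sphere, above the greatest one.\<close>
    have "mu + 1 / K \<le> mu"
      unfolding mu_def
    proof (rule cINF_greatest[OF ne], fold mu_def)
      fix x assume "x \<in> ?S"
      then show "mu + 1 / K \<le> quad_form n a x"
        using key[of x] \<open>K > 0\<close> by (simp add: b_form field_simps)
    qed
    then show False using \<open>K > 0\<close> by simp
  qed
  moreover have "?B = char_matrix (A n) mu"
    by (rule eq_matI) (auto simp: char_matrix_def A_def b_def)
  ultimately have "eigenvalue (A n) mu"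
    by (subst eigenvalue_det[of _ n]) (auto simp: A_def)
  then have "mu > 0" by (rule ev)
  show ?thesis
    unfolding pos_def_def
  proof (intro conjI allI impI)
    fix x :: "nat \<Rightarrow> real" assume "\<exists>i<n. x i \<noteq> 0"
    then have "?N x > 0" by (auto intro: sum_pos2)
    then have "mu * ?N x > 0" using \<open>mu > 0\<close> by simp
    then show "quad_form n a x > 0" using mu_le[of x] by simp
  qed (rule sym)
qed

section \<open>Forms of level two\<close>

text \<open>Off-diagonal terms occur twice by symmetry, and the diagonal coefficients are
  even.\<close>

lemma even_quad_form:
  fixes a :: "nat \<Rightarrow> nat \<Rightarrow> int"
  assumes sym: "\<And>i j. a i j = a j i" and diag: "\<And>i. even (a i i)"
  shows "even (quad_form n a x)"
proof (induction n)
  case 0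
  show ?case by (simp add: quad_form_def)
next
  case (Suc n)
  then show ?case using diag by (simp add: quad_form_Suc[of a, OF sym])
qed

section \<open>From integer matrices to quadratic forms, and the determinant at a given
  level\<close>

text \<open>Extension by 0 makes symmetry and evenness of the diagonal hold at all indices, as
  \<open>pos_def\<close> and \<open>even_quad_form\<close> require.\<close>

definition form_coeff :: "nat \<Rightarrow> int mat \<Rightarrow> nat \<Rightarrow> nat \<Rightarrow> int" where
  "form_coeff v A i j = (if i < v \<and> j < v then A $$ (i, j) else 0)"

lemma form_coeff_sym:
  assumes "even_pd_form v A"
  shows "form_coeff v A i j = form_coeff v A j i"
proof -
  have "A $$ (i, j) = A $$ (j, i)" if "i < v" "j < v"
    using assms that unfolding even_pd_form_def by (metis carrier_matD index_transpose_mat(1))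
  then show ?thesis by (auto simp: form_coeff_def)
qed

lemma map_mat_form_coeff:
  "A \<in> carrier_mat v v \<Longrightarrow> mat v v (\<lambda>(i, j). of_int (form_coeff v A i j)) = map_mat of_int A"
  by (rule eq_matI) (auto simp: form_coeff_def)

lemma qf_eq_quad_form:
  assumes "A \<in> carrier_mat v v" "x \<in> carrier_vec v"
  shows "qf A x = quad_form v (form_coeff v A) (\<lambda>i. x $ i)"
proof -
  have "qf A x = (\<Sum>i = 0..<v. x $ i * (\<Sum>j = 0..<v. A $$ (i, j) * x $ j))"
    using assms by (simp add: qf_def scalar_prod_def)
  then show ?thesis
    by (simp add: quad_form_def form_coeff_def lessThan_atLeast0 sum_distrib_left mult_ac)
qed

lemma pos_def_form_coeff:
  assumes "even_pd_form v A"
  shows "pos_def v (\<lambda>i j. real_of_int (form_coeff v A i j))"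
proof (rule pos_def_of_eigenvalues)
  show "real_of_int (form_coeff v A i j) = real_of_int (form_coeff v A j i)" for i j
    using form_coeff_sym[OF assms, of i j] by simp
next
  fix k assume "eigenvalue (mat v v (\<lambda>(i, j). real_of_int (form_coeff v A i j))) k"
  then show "k > 0"
    using assms by (simp add: even_pd_form_def map_mat_form_coeff)
qed

lemma of_int_quad_form:
  "quad_form n (\<lambda>i j. of_int (a i j)) (\<lambda>i. of_int (x i)) = of_int (quad_form n a x)"
  by (simp add: quad_form_def)

lemma even_pd_form_det_pos:
  assumes "even_pd_form v A"
  shows "det A > 0"
proof -
  have A: "A \<in> carrier_mat v v"
    using assms by (simp add: even_pd_form_def)
  have "det (map_mat real_of_int A) > 0"
    \<comment> \<open>Only the determinant part is wanted, so the integrand is taken to be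
      0.\<close>
    using nn_integral_quad_form[OF pos_def_form_coeff[OF assms], of "\<lambda>_. 0"]
    by (simp add: map_mat_form_coeff[OF A])
  then show ?thesis by simp
qed

text \<open>The least number has the property once some number has it. Twice the determinant works:
  the inverse is the adjugate divided by the determinant, and the factor 2 makes the diagonal
  even.\<close>

lemma level_ok_form_level:
  assumes "even_pd_form v A"
  shows "level_ok v A (form_level v A)"
proof -
  have A: "A \<in> carrier_mat v v"
    using assms by (simp add: even_pd_form_def)
  have det: "det A > 0"
    using assms by (rule even_pd_form_det_pos)
  let ?f = "map_mat rat_of_int"
  note adj = adj_mat[OF A]
  let ?B = "(1 / rat_of_int (det A)) \<cdot>\<^sub>m ?f (adj_mat A)"
  have hom: "?f (det A \<cdot>\<^sub>m 1\<^sub>m v) = rat_of_int (det A) \<cdot>\<^sub>m 1\<^sub>m v"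
    by (rule eq_matI) auto
  have "?f A * ?B = 1\<^sub>m v"
  proof -
    have "?f A * ?f (adj_mat A) = rat_of_int (det A) \<cdot>\<^sub>m 1\<^sub>m v"
      using of_int_hom.mat_hom_mult[OF A adj(1), where 'a = rat] adj(2) hom by simp
    moreover have "?f A * ?B = (1 / rat_of_int (det A)) \<cdot>\<^sub>m (?f A * ?f (adj_mat A))"
      using A adj(1) by (intro mult_smult_distrib) auto
    ultimately show ?thesis
      using det by (auto intro!: eq_matI)
  qed
  moreover have "?B * ?f A = 1\<^sub>m v"
  proof -
    have "?f (adj_mat A) * ?f A = rat_of_int (det A) \<cdot>\<^sub>m 1\<^sub>m v"
      using of_int_hom.mat_hom_mult[OF adj(1) A, where 'a = rat] adj(3) hom by simp
    moreover have "?B * ?f A = (1 / rat_of_int (det A)) \<cdot>\<^sub>m (?f (adj_mat A) * ?f A)"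
      using A adj(1) by (intro mult_smult_assoc_mat) auto
    ultimately show ?thesis
      using det by (auto intro!: eq_matI)
  qed
  moreover have entry: "of_nat (2 * nat (det A)) * ?B $$ (i, j) = of_int (2 * adj_mat A $$ (i, j))"
    if "i < v" "j < v" for i j
    using that det adj(1) by simp
  ultimately have "level_ok v A (2 * nat (det A))"
    unfolding level_ok_def using adj(1)
    by (intro bexI[of _ ?B] conjI allI impI) (auto simp only: entry intro: Ints_of_int, auto)
  then have "\<exists>N. N > 0 \<and> level_ok v A N"
    using det by (intro exI[of _ "2 * nat (det A)"]) simp
  from LeastI_ex[OF this] show ?thesis
    by (simp add: form_level_def)
qed

text \<open>The matrix C = N A^-1 is integral and det A det C = N^v. Hence det C is a positive
  integer, so at least 1.\<close>

lemma det_le_of_level_ok: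
  assumes "A \<in> carrier_mat v v" "det A > 0" "level_ok v A N" "N > 0"
  shows "det A \<le> int N ^ v"
proof -
  obtain B where B: "B \<in> carrier_mat v v" "map_mat rat_of_int A * B = 1\<^sub>m v"
    and int: "\<And>i j. i < v \<Longrightarrow> j < v \<Longrightarrow> of_nat N * B $$ (i, j) \<in> \<int>"
    using assms(3) unfolding level_ok_def by blast
  \<comment> \<open>The entries are already integral, so the floor only changes their type.\<close>
  define C where "C = mat v v (\<lambda>(i, j). \<lfloor>of_nat N * B $$ (i, j)\<rfloor>)"
  have C: "C \<in> carrier_mat v v" by (simp add: C_def)
  have "map_mat rat_of_int C = of_nat N \<cdot>\<^sub>m B"
    using int B(1) by (intro eq_matI) (auto simp: C_def elim!: Ints_cases)
  then have "det (map_mat rat_of_int C) = of_nat N ^ v * det B"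
    using B(1) by (simp add: det_smult)
  moreover have "det (map_mat rat_of_int A) * det B = 1"
    using det_mult[of "map_mat rat_of_int A" v B] B assms(1) by simp
  ultimately have "rat_of_int (det A * det C) = rat_of_int (int N ^ v)"
    by (simp add: mult.left_commute)
  then have eq: "det A * det C = int N ^ v"
    by (simp only: of_int_eq_iff)
  then have "det A * det C > 0" using assms(4) by simp
  then have "det C > 0" using assms(2) by (simp add: zero_less_mult_iff)
  then have "det A * 1 \<le> det A * det C" using assms(2) by (intro mult_left_mono) auto
  then show ?thesis using eq by simp
qed

text \<open>Covers both residue classes with v = 2m. If a claim failed for v = 8q or v = 8q + 4, all
  nonzero vectors would have even values above 2q + 2, so at least 2q + 4, while (m + 6) / 2 is 2q +
  3 or 2q + 4 respectively.\<close>

lemma short_vector_of_level_two: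
  assumes pd: "even_pd_form (2 * m) A" and level: "form_level (2 * m) A = 2" and m: "m \<ge> 2"
  obtains n x where "n > 0" "4 * n < m + 6" "x \<in> carrier_vec (2 * m)" "qf A x = int (2 * n)"
proof -
  let ?a = "form_coeff (2 * m) A" and ?d = "(real m + 6) / 2"
  let ?r = "\<lambda>i j. real_of_int (?a i j)"
  have A: "A \<in> carrier_mat (2 * m) (2 * m)"
    using pd by (simp add: even_pd_form_def)
  have "\<exists>l::nat \<Rightarrow> int. (\<exists>i<2*m. l i \<noteq> 0) \<and> quad_form (2 * m) ?r (\<lambda>i. of_int (l i)) < ?d"
  proof (rule ccontr)
    assume "\<not> ?thesis"
    then have "?d \<le> quad_form (2 * m) ?r (\<lambda>i. of_int (l i))"
      if "\<exists>i<2*m. l i \<noteq> 0" for l :: "nat \<Rightarrow> int"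
      using that by (meson not_less)
    from blichfeldt_bound[OF pos_def_form_coeff[OF pd] _ this]
    have "(pi * ?d / 2) ^ m / fact (Suc m) \<le> sqrt (real_of_int (det A))"
      by (simp add: map_mat_form_coeff[OF A] del: fact_Suc)
    also have "real_of_int (det A) \<le> (2 ^ m)\<^sup>2"
    proof -
      have "det A \<le> int 2 ^ (2 * m)"
        using level_ok_form_level[OF pd] level
        by (intro det_le_of_level_ok[OF A even_pd_form_det_pos[OF pd]]) auto
      then have "real_of_int (det A) \<le> real_of_int (int 2 ^ (2 * m))"
        by (simp only: of_int_le_iff)
      then show ?thesis by (simp add: power_mult[of _ m 2] mult.commute[of 2 m])
    qed
    finally have "(pi * ?d / 2) ^ m / fact (Suc m) \<le> 2 ^ m"
      by simp
    then have "(pi * ?d / 2) ^ m \<le> 2 ^ m * fact (Suc m)"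
      by (simp add: divide_le_eq del: fact_Suc)
    \<comment> \<open>Since pi d / 2 is twice pi (m + 6) / 8, the factor \<open>2 ^ m\<close> from
      the determinant cancels and what remains contradicts
      \<open>fact_less_blichfeldt\<close>.\<close>
    moreover have "(pi * ?d / 2) ^ m = 2 ^ m * (pi * (m + 6) / 8) ^ m"
      by (simp flip: power_mult_distrib)
    ultimately show False
      using fact_less_blichfeldt[OF m] by (simp del: fact_Suc)
  qed
  then obtain l :: "nat \<Rightarrow> int" where l: "\<exists>i<2*m. l i \<noteq> 0"
    and lt: "quad_form (2 * m) ?r (\<lambda>i. of_int (l i)) < ?d" by blast
  define x where "x = vec (2 * m) l"
  have x: "x \<in> carrier_vec (2 * m)" by (simp add: x_def)
  have qf: "qf A x = quad_form (2 * m) ?a l"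
    unfolding qf_eq_quad_form[OF A x] by (rule quad_form_cong) (simp add: x_def)
  have "\<exists>i<2*m. real_of_int (l i) \<noteq> 0" using l by simp
  then have "quad_form (2 * m) ?r (\<lambda>i. of_int (l i)) > 0"
    using pos_def_form_coeff[OF pd, unfolded pos_def_def, THEN conjunct2,
        THEN spec[of _ "\<lambda>i. real_of_int (l i)"]] by blast
  then have pos: "qf A x > 0" by (simp add: of_int_quad_form qf)
  have "even (qf A x)"
    unfolding qf using pd
    by (intro even_quad_form form_coeff_sym[OF pd]) (simp add: form_coeff_def even_pd_form_def)
  then obtain k where k: "qf A x = 2 * k" by blast
  have "real_of_int (qf A x) < ?d" using lt by (simp add: of_int_quad_form qf)
  then have "real_of_int (4 * k) < real_of_int (int m + 6)" using k by simp
  then have "4 * k < int m + 6" by (simp only: of_int_less_iff)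
  with k pos have "nat k > 0" "4 * nat k < m + 6" "qf A x = int (2 * nat k)" by auto
  then show ?thesis using x that by blast
qed

theorem theorem3p1:
  fixes v :: nat and A :: "int mat"
  assumes "even_pd_form v A"
    and "form_level v A = 2"
  shows "(8 dvd v \<longrightarrow>
           (\<exists>n::nat. n > 0 \<and> real (2 * n) \<le> 2 + real v / 4 \<and>
              (\<exists>x \<in> carrier_vec v. qf A x = int (2 * n))))
       \<and> (v mod 8 = 4 \<longrightarrow>
           (\<exists>n::nat. n > 0 \<and> real (2 * n) \<le> 1 + real v / 4 \<and>
              (\<exists>x \<in> carrier_vec v. qf A x = int (2 * n))))"
proof (intro conjI impI)
  assume "8 dvd v"
  then obtain q where q: "v = 8 * q" by blast
  \<comment> \<open>The dimension 0 is divisible by 8 as well; it is excluded because the empty form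
    has level 1.\<close>
  have "v \<noteq> 0"
  proof
    assume "v = 0"
    then have "level_ok v A 1"
      using assms(1) by (auto simp: level_ok_def even_pd_form_def intro!: bexI[of _ "1\<^sub>m 0"])
    then have "form_level v A \<le> 1"
      unfolding form_level_def by (intro Least_le) simp
    then show False using assms(2) by simp
  qed
  then have v: "v = 2 * (4 * q)" "4 * q \<ge> 2" using q by auto
  obtain n x where "n > 0" "4 * n < 4 * q + 6" "x \<in> carrier_vec v" "qf A x = int (2 * n)"
    using short_vector_of_level_two[of "4 * q" A] assms v by metis
  \<comment> \<open>From 4n < 4q + 6, and 2(q + 1) = 2 + v/4 for v = 8q.\<close>
  moreover from this have "n \<le> q + 1" by linarith
  then have "real (2 * n) \<le> 2 + real v / 4" using q by simp
  ultimately show "\<exists>n::nat. n > 0 \<and> real (2 * n) \<le> 2 + real v / 4 \<and>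
      (\<exists>x \<in> carrier_vec v. qf A x = int (2 * n))" by blast
next
  assume "v mod 8 = 4"
  then obtain q where q: "v = 8 * q + 4" by (metis mult_div_mod_eq)
  then have v: "v = 2 * (4 * q + 2)" "4 * q + 2 \<ge> 2" by auto
  obtain n x where "n > 0" "4 * n < 4 * q + 2 + 6" "x \<in> carrier_vec v" "qf A x = int (2 * n)"
    using short_vector_of_level_two[of "4 * q + 2" A] assms v by metis
  \<comment> \<open>The strict inequality 4n < 4(q + 2) is what excludes n = q + 2; here 2(q + 1) =
    1 + v/4.\<close>
  moreover from this have "n \<le> q + 1" by linarith
  then have "real (2 * n) \<le> 1 + real v / 4" using q by (simp add: field_simps)
  ultimately show "\<exists>n::nat. n > 0 \<and> real (2 * n) \<le> 1 + real v / 4 \<and>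
      (\<exists>x \<in> carrier_vec v. qf A x = int (2 * n))" by blast
qed

end
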